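(* Let $g$ satisfy (A1) and (A2), let $S=\{S_t\}_{0\le t\le T}$ satisfy (A5), and let $\xi_1,\xi_2\in L^2(\Omega,\mathcal F_T,P)$ satisfy $S_T\le \xi_1$ a.s. and $S_T\le\xi_2$ a.s. Assume moreover that $\xi_1\le\xi_2$ a.s. and $P(\{\xi_1<\xi_2\})>0$. Let $(Y^1,Z^1,K^1)$ and $(Y^2,Z^2,K^2)$ be the adapted solutions of the reflected BSDE with data $(\xi_1,g,S)$ and $(\xi_2,g,S)$, respectively. Then there exists a stopping time $\tau$ such that $\tau<T$ almost surely and $$P(\{Y^1_t<Y^2_t,\ \forall t\in[\tau,T]\})>0 .$$
   Context: Setting: $(\Omega,\mathcal F,P)$ is a probability space, $\{B_t\}_{t\ge0}$ a $d$-dimensional standard Brownian motion with $B_0=0$, $\mathcal F_t=\sigma\{B_s:s\in[0,t]\}\vee\mathcal N$ with $\mathcal N$ the $P$-null sets, and $T>0$ is a fixed real number. $\mathcal H^2(0,T;\mathbf R^n)$ is the set of $\mathbf R^n$-valued predictable processes $\psi$ with $E\int_0^T|\psi_t|^2dt<\infty$; $\mathcal S^2(0,T;\mathbf R)$ is the set of real predictable processes $\psi$ with $E[\sup_{0\le t\le T}|\psi_t|^2]<\infty$. A generator is a map $g:\Omega\times[0,T]\times\mathbf R\times\mathbf R^d\to\mathbf R$ such that $\{g(t,y,z)\}_{t\in[0,T]}$ is progressively measurable for each $(y,z)$. Assumptions: (A1) there is a constant $K>0$ such that a.s. $|g(t,y_1,z_1)-g(t,y_2,z_2)|\le K(|y_1-y_2|+|z_1-z_2|)$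 for all $t\in[0,T]$, $y_1,y_2\in\mathbf R$, $z_1,z_2\in\mathbf R^d$. (A2) $g(\cdot,0,0)\in\mathcal H^2(0,T;\mathbf R)$. (A5) $\{S_t\}_{0\le t\le T}$ is a continuous process belonging to $\mathcal S^2(0,T;\mathbf R)$. Reflected BSDE with data $(\xi,g,S)$: its solution is a triple $(Y,Z,K)$ of $\mathcal F_t$-progressively measurable processes with values in $\mathbf R\times\mathbf R^d\times\mathbf R_+$ such that (i) $Z\in\mathcal H^2(0,T;\mathbf R^d)$, $Y\in\mathcal S^2(0,T;\mathbf R)$, $K_T\in L^2(\Omega,\mathcal F_T,P)$; (ii) $Y_t=\xi+\int_t^Tg(s,Y_s,Z_s)ds+K_T-K_t-\int_t^TZ_sdB_s$ for $t\in[0,T]$ (so $Y$ has continuous paths); (iii) $Y_t\ge S_t$ a.s. for any $t\in[0,T]$; (iv) $K$ is continuous and increasing, $K_0=0$, and $\int_0^T(Y_t-S_t)dK_t=0$. If $g$ satisfies (A1), (A2), $S$ satisfies (A5), $\xi\in L^2(\Omega,\mathcal F_T,P)$ and $S_T\le\xi$ a.s., this solution exists and is unique. *)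

theory Defs
  imports "HOL-Probability.Probability"
begin

section \<open>Brownian motion and its augmented filtration\<close>

definition brownian_motion :: "'a measure \<Rightarrow> (real \<Rightarrow> 'a \<Rightarrow> real^'d::finite) \<Rightarrow> bool" where
  "brownian_motion M B \<longleftrightarrow>
     (\<forall>t\<ge>0. B t \<in> borel_measurable M) \<and>
     (AE \<omega> in M. B 0 \<omega> = 0) \<and>
     (AE \<omega> in M. continuous_on {0..} (\<lambda>t. B t \<omega>)) \<and>
     (\<forall>(n::nat) t. 0 \<le> t 0 \<and> (\<forall>k<n. t k < t (Suc k)) \<longrightarrow>
        prob_space.indep_vars M (\<lambda>_. borel) (\<lambda>k \<omega>. B (t (Suc k)) \<omega> - B (t k) \<omega>) {..<n}) \<and>
     (\<forall>s t. 0 \<le> s \<and> s < t \<longrightarrow>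
        prob_space.indep_vars M (\<lambda>_. borel) (\<lambda>i \<omega>. (B t \<omega> - B s \<omega>) $ i) (UNIV :: 'd set) \<and>
        (\<forall>i. distributed M lborel (\<lambda>\<omega>. (B t \<omega> - B s \<omega>) $ i)
               (\<lambda>x. ennreal (normal_density 0 (sqrt (t - s)) x))))"

text \<open>The filtration is indexed by all reals, as the library notion of stopping time quantifies
  over the whole index type; at a negative time only the null sets generate it.\<close>

definition brownian_filtration ::
  "'a measure \<Rightarrow> (real \<Rightarrow> 'a \<Rightarrow> real^'d::finite) \<Rightarrow> real \<Rightarrow> 'a measure" where
  "brownian_filtration M B t =
     sigma (space M)
       ((\<Union>s\<in>{0..t}. {B s -` A \<inter> space M | A. A \<in> sets borel}) \<union> null_sets M)"


section \<open>Classes of processes\<close>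

definition progressively_measurable ::
  "(real \<Rightarrow> 'a measure) \<Rightarrow> real \<Rightarrow> (real \<Rightarrow> 'a \<Rightarrow> 'b::topological_space) \<Rightarrow> bool" where
  "progressively_measurable F T X \<longleftrightarrow>
     (\<forall>t\<in>{0..T}. (\<lambda>(s, \<omega>). X s \<omega>) \<in> borel_measurable (restrict_space borel {0..t} \<Otimes>\<^sub>M F t))"

definition predictable_algebra :: "(real \<Rightarrow> 'a measure) \<Rightarrow> real \<Rightarrow> (real \<times> 'a) measure" where
  "predictable_algebra F T =
     sigma ({0..T} \<times> space (F 0))
       ({{0} \<times> A | A. A \<in> sets (F 0)} \<union>
        {{s<..t} \<times> A | s t A. 0 \<le> s \<and> s < t \<and> t \<le> T \<and> A \<in> sets (F s)})"

definition predictable ::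
  "(real \<Rightarrow> 'a measure) \<Rightarrow> real \<Rightarrow> (real \<Rightarrow> 'a \<Rightarrow> 'b::topological_space) \<Rightarrow> bool" where
  "predictable F T X \<longleftrightarrow> (\<lambda>(t, \<omega>). X t \<omega>) \<in> borel_measurable (predictable_algebra F T)"

definition H2_process ::
  "'a measure \<Rightarrow> (real \<Rightarrow> 'a measure) \<Rightarrow> real \<Rightarrow> (real \<Rightarrow> 'a \<Rightarrow> 'b::euclidean_space) \<Rightarrow> bool" where
  "H2_process M F T \<psi> \<longleftrightarrow> predictable F T \<psi> \<and>
     (\<integral>\<^sup>+\<omega>. (\<integral>\<^sup>+t\<in>{0..T}. ennreal ((norm (\<psi> t \<omega>))\<^sup>2) \<partial>lborel) \<partial>M) < \<infinity>"

definition S2_process ::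
  "'a measure \<Rightarrow> (real \<Rightarrow> 'a measure) \<Rightarrow> real \<Rightarrow> (real \<Rightarrow> 'a \<Rightarrow> real) \<Rightarrow> bool" where
  "S2_process M F T \<psi> \<longleftrightarrow> predictable F T \<psi> \<and>
     (\<integral>\<^sup>+\<omega>. (SUP t\<in>{0..T}. ennreal (\<bar>\<psi> t \<omega>\<bar>\<^sup>2)) \<partial>M) < \<infinity>"

definition L2_rv :: "'a measure \<Rightarrow> 'a measure \<Rightarrow> ('a \<Rightarrow> real) \<Rightarrow> bool" where
  "L2_rv M G X \<longleftrightarrow> X \<in> borel_measurable G \<and> integrable M (\<lambda>\<omega>. (X \<omega>)\<^sup>2)"


section \<open>The stochastic integral\<close>

text \<open>The Ito integral is the continuous process obtained as the mean-square limit of the integrals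
  of simple processes \<open>\<Sum>k<n. \<eta> k * 1_{(t k, t (k+1)]}\<close>. It is determined only up to
  indistinguishability, hence it is defined as a relation between integrand and integral.\<close>

definition simple_data ::
  "(real \<Rightarrow> 'a measure) \<Rightarrow> real \<Rightarrow> nat \<Rightarrow> (nat \<Rightarrow> real) \<Rightarrow> (nat \<Rightarrow> 'a \<Rightarrow> real^'d::finite) \<Rightarrow> bool" where
  "simple_data F T n t \<eta> \<longleftrightarrow>
     0 \<le> t 0 \<and> t n \<le> T \<and>
     (\<forall>k<n. t k < t (Suc k) \<and> \<eta> k \<in> borel_measurable (F (t k)) \<and>
        bounded (\<eta> k ` space (F (t k))))"

definition simple_process ::
  "nat \<Rightarrow> (nat \<Rightarrow> real) \<Rightarrow> (nat \<Rightarrow> 'a \<Rightarrow> real^'d::finite) \<Rightarrow> real \<Rightarrow> 'a \<Rightarrow> real^'d" where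
  "simple_process n t \<eta> s \<omega> = (\<Sum>k<n. indicat_real {t k<..t (Suc k)} s *\<^sub>R \<eta> k \<omega>)"

definition simple_integral ::
  "(real \<Rightarrow> 'a \<Rightarrow> real^'d::finite) \<Rightarrow> nat \<Rightarrow> (nat \<Rightarrow> real) \<Rightarrow> (nat \<Rightarrow> 'a \<Rightarrow> real^'d) \<Rightarrow> real \<Rightarrow> 'a \<Rightarrow> real" where
  "simple_integral B n t \<eta> s \<omega> =
     (\<Sum>k<n. \<eta> k \<omega> \<bullet> (B (min (t (Suc k)) s) \<omega> - B (min (t k) s) \<omega>))"

definition ito_integral ::
  "'a measure \<Rightarrow> (real \<Rightarrow> 'a \<Rightarrow> real^'d::finite) \<Rightarrow> real \<Rightarrow> (real \<Rightarrow> 'a \<Rightarrow> real^'d) \<Rightarrow> (real \<Rightarrow> 'a \<Rightarrow> real) \<Rightarrow> bool" where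
  "ito_integral M B T Z I \<longleftrightarrow>
     (\<forall>s\<in>{0..T}. I s \<in> borel_measurable (brownian_filtration M B s)) \<and>
     (AE \<omega> in M. continuous_on {0..T} (\<lambda>s. I s \<omega>)) \<and>
     (\<exists>n t \<eta>.
        (\<forall>j::nat. simple_data (brownian_filtration M B) T (n j) (t j) (\<eta> j)) \<and>
        (\<lambda>j. \<integral>\<^sup>+\<omega>. (\<integral>\<^sup>+s\<in>{0..T}.
               ennreal ((norm (Z s \<omega> - simple_process (n j) (t j) (\<eta> j) s \<omega>))\<^sup>2) \<partial>lborel) \<partial>M)
          \<longlonglongrightarrow> 0 \<and>
        (\<forall>s\<in>{0..T}.
           (\<lambda>j. \<integral>\<^sup>+\<omega>. ennreal ((I s \<omega> - simple_integral B (n j) (t j) (\<eta> j) s \<omega>)\<^sup>2) \<partial>M)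
             \<longlonglongrightarrow> 0))"


section \<open>Generators, obstacles and the reflected BSDE\<close>

definition generator ::
  "(real \<Rightarrow> 'a measure) \<Rightarrow> real \<Rightarrow> ('a \<Rightarrow> real \<Rightarrow> real \<Rightarrow> real^'d::finite \<Rightarrow> real) \<Rightarrow> bool" where
  "generator F T g \<longleftrightarrow> (\<forall>y z. progressively_measurable F T (\<lambda>t \<omega>. g \<omega> t y z))"

definition cond_A1 ::
  "'a measure \<Rightarrow> real \<Rightarrow> ('a \<Rightarrow> real \<Rightarrow> real \<Rightarrow> real^'d::finite \<Rightarrow> real) \<Rightarrow> bool" where
  "cond_A1 M T g \<longleftrightarrow> (\<exists>C>0. AE \<omega> in M. \<forall>t\<in>{0..T}. \<forall>y1 y2 z1 z2.
     \<bar>g \<omega> t y1 z1 - g \<omega> t y2 z2\<bar> \<le> C * (\<bar>y1 - y2\<bar> + norm (z1 - z2)))"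

definition cond_A2 ::
  "'a measure \<Rightarrow> (real \<Rightarrow> 'a measure) \<Rightarrow> real \<Rightarrow> ('a \<Rightarrow> real \<Rightarrow> real \<Rightarrow> real^'d::finite \<Rightarrow> real) \<Rightarrow> bool" where
  "cond_A2 M F T g \<longleftrightarrow> H2_process M F T (\<lambda>t \<omega>. g \<omega> t 0 0)"

definition cond_A5 ::
  "'a measure \<Rightarrow> (real \<Rightarrow> 'a measure) \<Rightarrow> real \<Rightarrow> (real \<Rightarrow> 'a \<Rightarrow> real) \<Rightarrow> bool" where
  "cond_A5 M F T S \<longleftrightarrow>
     (AE \<omega> in M. continuous_on {0..T} (\<lambda>t. S t \<omega>)) \<and> S2_process M F T S"

text \<open>The integral against \<open>dK\<close> is the pathwise Lebesgue-Stieltjes integral. Since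
  \<^const>\<open>interval_measure\<close> needs a distribution function on the whole real line, the path of \<open>K\<close> is
  extended constantly outside \<open>[0,T]\<close>, which puts no mass there.\<close>

definition rbsde_solution ::
  "'a measure \<Rightarrow> (real \<Rightarrow> 'a \<Rightarrow> real^'d::finite) \<Rightarrow> real \<Rightarrow>
   ('a \<Rightarrow> real) \<Rightarrow> ('a \<Rightarrow> real \<Rightarrow> real \<Rightarrow> real^'d \<Rightarrow> real) \<Rightarrow> (real \<Rightarrow> 'a \<Rightarrow> real) \<Rightarrow>
   (real \<Rightarrow> 'a \<Rightarrow> real) \<Rightarrow> (real \<Rightarrow> 'a \<Rightarrow> real^'d) \<Rightarrow> (real \<Rightarrow> 'a \<Rightarrow> real) \<Rightarrow> bool" where
  "rbsde_solution M B T \<xi> g S Y Z K \<longleftrightarrow>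
     (let F = brownian_filtration M B in
      progressively_measurable F T Y \<and> progressively_measurable F T Z \<and>
      progressively_measurable F T K \<and> (\<forall>t\<in>{0..T}. \<forall>\<omega>\<in>space M. 0 \<le> K t \<omega>) \<and>
      H2_process M F T Z \<and> S2_process M F T Y \<and> L2_rv M (F T) (K T) \<and>
      (\<exists>I. ito_integral M B T Z I \<and>
         (AE \<omega> in M. \<forall>t\<in>{0..T}.
            Y t \<omega> = \<xi> \<omega> + (LINT s:{t..T}|lborel. g \<omega> s (Y s \<omega>) (Z s \<omega>))
                    + K T \<omega> - K t \<omega> - (I T \<omega> - I t \<omega>))) \<and>
      (\<forall>t\<in>{0..T}. AE \<omega> in M. S t \<omega> \<le> Y t \<omega>) \<and>
      (AE \<omega> in M. continuous_on {0..T} (\<lambda>t. K t \<omega>) \<and> mono_on {0..T} (\<lambda>t. K t \<omega>) \<and> K 0 \<omega> = 0 \<and>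
         (LINT t:{0..T}|interval_measure (\<lambda>t. K (max 0 (min t T)) \<omega>). Y t \<omega> - S t \<omega>) = 0))"

end

theory Submission
  imports Defs
begin

text \<open>The generator evaluated along a solution is almost surely integrable over \<open>[0,T]\<close>, so
  \<open>Y2 - Y1\<close> has continuous paths and ends at \<open>\<xi>2 - \<xi>1\<close>. Every path with \<open>\<xi>1 < \<xi>2\<close> therefore satisfies
  \<open>Y1 < Y2\<close> on some interval \<open>[T - \<epsilon>, T]\<close>, and by continuity of the measure one deterministic \<open>\<epsilon>\<close>
  serves a set of paths of positive probability. Hence a constant time \<open>\<tau>\<close> suffices.\<close>

section \<open>Positivity of a random path on a whole terminal interval\<close>

text \<open>Trades an uncountable family of conditions for countably many, so that the event becomes
  measurable. The uniform margin \<open>inverse (real (Suc m))\<close> is essential: strict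
  positivity at rational times may be lost in the limit, whereas a weak inequality extends to the
  closure. Conversely, compactness supplies the margin, because the minimum is attained and
  positive.\<close>

lemma positive_on_interval_iff_rationals:
  fixes f :: "real \<Rightarrow> real"
  assumes cont: "continuous_on {a..b} f" and "a < b"
  shows "(\<forall>t\<in>{a..b}. 0 < f t) \<longleftrightarrow> (\<exists>m. \<forall>q\<in>{a<..<b} \<inter> \<rat>. inverse (real (Suc m)) \<le> f q)"
proof
  assume pos: "\<forall>t\<in>{a..b}. 0 < f t"
  obtain x where x: "x \<in> {a..b}" "\<forall>y\<in>{a..b}. f x \<le> f y"
    using continuous_attains_inf[OF compact_Icc _ cont] \<open>a < b\<close> by auto
  then obtain m where "inverse (real (Suc m)) < f x"
    using reals_Archimedean pos by blast
  with x show "\<exists>m. \<forall>q\<in>{a<..<b} \<inter> \<rat>. inverse (real (Suc m)) \<le> f q"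
    by (intro exI[of _ m] ballI) (force intro: order_trans[OF less_imp_le])
next
  assume "\<exists>m. \<forall>q\<in>{a<..<b} \<inter> \<rat>. inverse (real (Suc m)) \<le> f q"
  then obtain m where m: "\<And>q. q \<in> {a<..<b} \<inter> \<rat> \<Longrightarrow> inverse (real (Suc m)) \<le> f q"
    by blast
  have cl: "closure ({a<..<b} \<inter> \<rat>) = {a..b}"
    using closure_open_Int_superset[of "{a<..<b}" \<rat>] \<open>a < b\<close>
    by (simp add: Rats_closure_real)
  have "inverse (real (Suc m)) \<le> f t" if "t \<in> {a..b}" for t
    by (rule continuous_ge_on_closure[of "{a<..<b} \<inter> \<rat>"]) (use cl cont that m in auto)
  then show "\<forall>t\<in>{a..b}. 0 < f t"
    by (meson inverse_positive_iff_positive less_le_trans of_nat_0_less_iff zero_less_Suc)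
qed

text \<open>A path that is continuous and positive at \<open>T\<close> stays positive on some
  interval ending at \<open>T\<close>, and countably many starting points exhaust these intervals.
  If each had probability zero, so would their union, which contains the event
  \<open>0 < D T\<close> up to a null set. The conclusion uses the completion because paths are
  continuous only almost surely: the event differs from a measurable one by a subset of a null
  set.\<close>

lemma (in prob_space) positive_on_terminal_interval:
  fixes D :: "real \<Rightarrow> 'a \<Rightarrow> real"
  assumes meas: "\<And>t. t \<in> {0..T} \<Longrightarrow> D t \<in> borel_measurable M"
    and cont: "AE \<omega> in M. continuous_on {0..T} (\<lambda>t. D t \<omega>)"
    and "0 < T" and pos: "prob {\<omega> \<in> space M. 0 < D T \<omega>} > 0"
  shows "\<exists>a\<in>{0..<T}. measure (completion M) {\<omega> \<in> space M. \<forall>t\<in>{a..T}. 0 < D t \<omega>} > 0"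
proof (rule ccontr)
  assume neg: "\<not> ?thesis"
  \<comment> \<open>The starting points begin at \<open>a 0 = 0\<close>, stay in
    \<open>{0..<T}\<close> and tend to \<open>T\<close>.\<close>
  define a where "a n = T - T / (real n + 1)" for n :: nat
  have a: "0 \<le> a n" "a n < T" for n
    using \<open>0 < T\<close> by (auto simp: a_def field_simps)
  define P where "P n \<omega> \<longleftrightarrow> (\<forall>t\<in>{a n..T}. 0 < D t \<omega>)" for n \<omega>
  define Q where
    "Q n \<omega> \<longleftrightarrow> (\<exists>m. \<forall>q\<in>{a n<..<T} \<inter> \<rat>. inverse (real (Suc m)) \<le> D q \<omega>)" for n \<omega>
  have QM: "{\<omega> \<in> space M. Q n \<omega>} \<in> sets M" for n
  proof -
    have c: "countable ({a n<..<T} \<inter> \<rat>)"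
      using countable_rat by blast
    have "{\<omega> \<in> space M. inverse (real (Suc m)) \<le> D q \<omega>} \<in> sets M" if "q \<in> {a n<..<T} \<inter> \<rat>" for q m
    proof -
      have [measurable]: "D q \<in> borel_measurable M"
        using that a(1)[of n] by (intro meas) auto
      show ?thesis by measurable
    qed
    then show ?thesis
      unfolding Q_def by (intro sets.sets_Collect_countable_Ex sets.sets_Collect_countable_All'[OF _ c])
  qed
  have PQ: "AE \<omega> in M. P n \<omega> \<longleftrightarrow> Q n \<omega>" for n
    using cont
  proof eventually_elim
    case (elim \<omega>)
    then have "continuous_on {a n..T} (\<lambda>t. D t \<omega>)"
      by (rule continuous_on_subset) (use a[of n] in auto)
    then show ?case
      unfolding P_def Q_def by (rule positive_on_interval_iff_rationals[OF _ a(2)])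
  qed
  \<comment> \<open>\<open>Q n\<close> is a measurable event of \<open>M\<close>. Agreement with it
    almost everywhere makes \<open>P n\<close> measurable in the completion, with the same measure,
    so the negated goal passes from \<open>P n\<close> to \<open>Q n\<close>.\<close>
  have PQC: "AE \<omega> in completion M. \<omega> \<in> {\<omega> \<in> space M. Q n \<omega>} \<longleftrightarrow> \<omega> \<in> {\<omega> \<in> space M. P n \<omega>}" for n
    using AE_completion[OF PQ[of n]] by eventually_elim auto
  have PM: "{\<omega> \<in> space M. P n \<omega>} \<in> sets (completion M)" for n
    by (rule completion.in_sets_AE[OF PQC]) (use QM in auto)
  have Q0: "prob {\<omega> \<in> space M. Q n \<omega>} = 0" for n
  proof -
    have "prob {\<omega> \<in> space M. Q n \<omega>} = measure (completion M) {\<omega> \<in> space M. Q n \<omega>}"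
      by (rule measure_completion[symmetric]) (rule QM)
    also have "\<dots> = measure (completion M) {\<omega> \<in> space M. P n \<omega>}"
      by (rule measure_eq_AE[OF PQC _ PM]) (use QM in auto)
    finally show ?thesis
      using neg a[of n] unfolding P_def by (auto simp: not_less intro: antisym)
  qed
  have "AE \<omega> in M. \<not> Q n \<omega>" for n
    using Q0[of n] AE_space unfolding prob_eq_0[OF QM] by eventually_elim auto
  then have "AE \<omega> in M. \<not> P n \<omega>" for n
    using PQ[of n] by eventually_elim auto
  then have "AE \<omega> in M. \<forall>n. \<not> P n \<omega>"
    by (simp add: AE_all_countable)
  then have "AE \<omega> in M. \<not> 0 < D T \<omega>"
    using cont
  proof eventually_elim
    case (elim \<omega>)
    show ?case
    proof
      assume "0 < D T \<omega>"
      moreover have "continuous (at T within {0..T}) (\<lambda>t. D t \<omega>)"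
        using elim(2) \<open>0 < T\<close> by (auto simp: continuous_on_eq_continuous_within)
      \<comment> \<open>Taking the terminal value itself as the tolerance keeps the nearby values
        positive.\<close>
      ultimately obtain e where e: "e > 0" "\<And>t. t \<in> {0..T} \<Longrightarrow> dist t T < e \<Longrightarrow> dist (D t \<omega>) (D T \<omega>) < D T \<omega>"
        unfolding continuous_within_eps_delta by blast
      have "(\<lambda>n. T / (real n + 1)) \<longlonglongrightarrow> 0"
        by real_asymp
      then obtain n where n: "T / (real n + 1) < e"
        using e(1) by (metis (no_types, lifting) eventually_happens' order_tendstoD(2) sequentially_bot)
      have "0 < D t \<omega>" if "t \<in> {a n..T}" for t
        using e(2)[of t] that n a[of n] by (auto simp: a_def dist_real_def)
      then have "P n \<omega>" unfolding P_def by blast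
      then show False using elim(1) by blast
    qed
  qed
  then have "AE \<omega> in M. \<omega> \<notin> {\<omega> \<in> space M. 0 < D T \<omega>}"
    by eventually_elim auto
  moreover have "{\<omega> \<in> space M. 0 < D T \<omega>} \<in> sets M"
  proof -
    have [measurable]: "D T \<in> borel_measurable M"
      using meas \<open>0 < T\<close> by simp
    show ?thesis by measurable
  qed
  ultimately have "prob {\<omega> \<in> space M. 0 < D T \<omega>} = 0"
    using prob_eq_0 by blast
  with pos show False by simp
qed

section \<open>Joint measurability of predictable processes and measurability of
  compositions\<close>

lemma subalgebra_brownian_filtration:
  assumes "brownian_motion M B"
  shows "subalgebra M (brownian_filtration M B t)"
proof -
  have "(\<Union>s\<in>{0..t}. {B s -` A \<inter> space M | A. A \<in> sets borel}) \<union> null_sets M \<subseteq> sets M"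
    using assms by (auto simp: brownian_motion_def null_sets_def intro: measurable_sets)
  then show ?thesis
    unfolding subalgebra_def brownian_filtration_def
    by (simp add: space_measure_of_conv sets.sigma_sets_subset sets_measure_of_conv)
qed

text \<open>Every generator of the predictable sigma-algebra is a rectangle with a Borel time side
  and an event of some \<open>F s\<close>, hence of \<open>M\<close>. Joint measurability then
  serves both to integrate over time and to take sections at a fixed path or a fixed time.\<close>

lemma predictable_measurable_product:
  assumes sub: "\<And>t. subalgebra M (F t)" and pred: "predictable F T X"
  shows "(\<lambda>(t, \<omega>). X t \<omega>) \<in> borel_measurable (restrict_space lborel {0..T} \<Otimes>\<^sub>M M)"
proof -
  let ?N = "restrict_space lborel {0..T}"
  let ?G = "{{0} \<times> A | A. A \<in> sets (F 0)} \<union>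
    {{s<..t} \<times> A | s t A. 0 \<le> s \<and> s < t \<and> t \<le> T \<and> A \<in> sets (F s)}"
  have FM: "A \<in> sets M" if "A \<in> sets (F s)" for A s
    using sub that by (auto simp: subalgebra_def)
  have sp: "space (F s) = space M" for s
    using sub by (simp add: subalgebra_def)
  show ?thesis
  proof (cases "0 \<le> T")
    \<comment> \<open>The rectangles over time 0 lie in the product only when \<open>{0..T}\<close>
      contains 0. For negative \<open>T\<close> the product space is empty and measurability is
      trivial.\<close>
    case True
    have "{0} \<in> sets ?N"
      using True by (auto simp: sets_restrict_space_iff)
    moreover have "{s<..t} \<in> sets ?N" if "0 \<le> s" "t \<le> T" for s t
      using that by (auto simp: sets_restrict_space_iff)
    ultimately have G: "?G \<subseteq> sets (?N \<Otimes>\<^sub>M M)"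
      using FM by auto
    have S: "space (?N \<Otimes>\<^sub>M M) = {0..T} \<times> space (F 0)"
      by (simp add: space_pair_measure space_restrict_space sp)
    have "sets (predictable_algebra F T) \<subseteq> sets (?N \<Otimes>\<^sub>M M)"
      unfolding predictable_algebra_def S[symmetric]
      using sets.sigma_sets_subset[OF G] by (subst sets_measure_of[OF order_trans[OF G sets.space_closed]])
    then have "subalgebra (?N \<Otimes>\<^sub>M M) (predictable_algebra F T)"
      unfolding subalgebra_def using S by (simp add: predictable_algebra_def space_measure_of_conv)
    then show ?thesis
      using pred measurable_from_subalg unfolding predictable_def by blast
  next
    case False
    then have "space (?N \<Otimes>\<^sub>M M) = {}"
      by (simp add: space_pair_measure space_restrict_space)
    then show ?thesis
      by (auto simp: measurable_def)
  qed
qed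

text \<open>Needed because a generator is known to be measurable in time only for fixed
  \<open>(y, z)\<close>. Along a simple function the composition is glued from finitely many
  measurable pieces; continuity in the second argument carries measurability to the pointwise
  limit.\<close>

lemma borel_measurable_Caratheodory:
  fixes h :: "'s \<Rightarrow> 'b::{metric_space, second_countable_topology} \<Rightarrow> real"
  assumes h: "\<And>x. (\<lambda>s. h s x) \<in> borel_measurable N"
    and cont: "\<And>s. s \<in> space N \<Longrightarrow> continuous_on UNIV (h s)"
    and u: "u \<in> borel_measurable N"
  shows "(\<lambda>s. h s (u s)) \<in> borel_measurable N"
proof -
  obtain F where F: "\<And>i. simple_function N (F i)"
    "\<And>s. s \<in> space N \<Longrightarrow> (\<lambda>i. F i s) \<longlonglongrightarrow> u s"
    using borel_measurable_implies_sequence_metric[OF u, of undefined] by blast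
  show ?thesis
  proof (rule borel_measurable_LIMSEQ_metric)
    fix i
    have "F i \<in> measurable N (count_space (F i ` space N))"
      using F(1)[of i] by (auto simp: simple_function_def measurable_count_space_eq2)
    moreover have "countable (F i ` space N)"
      using F(1)[of i] by (auto simp: simple_function_def countable_finite)
    ultimately show "(\<lambda>s. h s (F i s)) \<in> borel_measurable N"
      using measurable_compose_countable'[where f="\<lambda>x s. h s x" and g="F i"] h by blast
  next
    fix s assume "s \<in> space N"
    with F(2) cont show "(\<lambda>i. h s (F i s)) \<longlonglongrightarrow> h s (u s)"
      by (metis UNIV_I continuous_on_tendsto_compose eventually_sequentiallyI)
  qed
qed

section \<open>Almost sure integrability of the generator along a solution\<close>

lemma (in finite_measure) integrable_norm_if_square_finite:
  fixes u :: "'a \<Rightarrow> 'b::{banach, second_countable_topology}"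
  assumes [measurable]: "u \<in> borel_measurable M"
    and "(\<integral>\<^sup>+s. ennreal ((norm (u s))\<^sup>2) \<partial>M) \<noteq> \<infinity>"
  shows "integrable M (\<lambda>s. norm (u s))"
  by (rule square_integrable_imp_integrable)
    (use assms(2) in \<open>auto intro!: integrableI_bounded simp: top.not_eq_extremum\<close>)

text \<open>A finite expectation makes the time integral of the square finite for almost every path,
  and on the bounded interval square integrability implies integrability.\<close>

lemma H2_process_AE_integrable:
  fixes \<psi> :: "real \<Rightarrow> 'a \<Rightarrow> 'b::euclidean_space"
  assumes sub: "\<And>t. subalgebra M (F t)" and H2: "H2_process M F T \<psi>"
  shows "AE \<omega> in M. integrable (restrict_space lborel {0..T}) (\<lambda>s. norm (\<psi> s \<omega>))"
proof -
  let ?N = "restrict_space lborel {0..T}"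
  interpret N: finite_measure ?N
    by (rule finite_measureI) (simp add: space_restrict_space emeasure_restrict_space emeasure_lborel_Icc_eq)
  have [measurable]: "(\<lambda>(t, \<omega>). \<psi> t \<omega>) \<in> borel_measurable (?N \<Otimes>\<^sub>M M)"
    using predictable_measurable_product[OF sub] H2 by (auto simp: H2_process_def)
  have [simp]: "(\<integral>\<^sup>+t\<in>{0..T}. f t \<partial>lborel) = (\<integral>\<^sup>+t. f t \<partial>?N)" for f :: "real \<Rightarrow> ennreal"
    by (subst nn_integral_restrict_space) auto
  have "AE \<omega> in M. (\<integral>\<^sup>+t. ennreal ((norm (\<psi> t \<omega>))\<^sup>2) \<partial>?N) \<noteq> \<infinity>"
    by (rule nn_integral_PInf_AE) (use H2 in \<open>auto simp: H2_process_def\<close>)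
  then show ?thesis
    using AE_space
    by eventually_elim (rule N.integrable_norm_if_square_finite; measurable)
qed

text \<open>The time integral of the square is at most \<open>T\<close> times its supremum. This
  lets \<open>Y\<close> be treated in the same way as \<open>Z\<close>.\<close>

lemma S2_process_imp_H2_process:
  assumes sub: "\<And>t. subalgebra M (F t)" and S2: "S2_process M F T \<psi>" and "0 < T"
  shows "H2_process M F T \<psi>"
proof -
  let ?N = "restrict_space lborel {0..T}"
  interpret N: finite_measure ?N
    by (rule finite_measureI) (simp add: space_restrict_space emeasure_restrict_space emeasure_lborel_Icc_eq)
  have [measurable]: "(\<lambda>(t, \<omega>). \<psi> t \<omega>) \<in> borel_measurable (?N \<Otimes>\<^sub>M M)"
    using predictable_measurable_product[OF sub] S2 by (auto simp: S2_process_def)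
  have R: "(\<integral>\<^sup>+t\<in>{0..T}. f t \<partial>lborel) = (\<integral>\<^sup>+t. f t \<partial>?N)" for f :: "real \<Rightarrow> ennreal"
    by (subst nn_integral_restrict_space) auto
  let ?J = "\<lambda>\<omega>. \<integral>\<^sup>+t. ennreal ((norm (\<psi> t \<omega>))\<^sup>2) \<partial>?N"
  let ?U = "\<lambda>\<omega>. SUP t\<in>{0..T}. ennreal (\<bar>\<psi> t \<omega>\<bar>\<^sup>2)"
  \<comment> \<open>The supremum need not be measurable, so the factor \<open>T\<close> is moved to the side of \<open>?J\<close>.\<close>
  have "ennreal (1 / T) * ?J \<omega> \<le> ?U \<omega>" for \<omega>
  proof -
    have "?J \<omega> \<le> (\<integral>\<^sup>+t. ?U \<omega> \<partial>?N)"
      by (rule nn_integral_mono) (auto simp: space_restrict_space intro!: SUP_upper)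
    also have "\<dots> = ennreal T * ?U \<omega>"
      using \<open>0 < T\<close> by (simp add: space_restrict_space emeasure_restrict_space mult.commute)
    finally have "ennreal (1 / T) * ?J \<omega> \<le> ennreal (1 / T) * (ennreal T * ?U \<omega>)"
      by (rule mult_left_mono) simp
    also have "\<dots> = ?U \<omega>"
      using \<open>0 < T\<close> by (simp add: mult.assoc[symmetric] ennreal_mult[symmetric])
    finally show ?thesis .
  qed
  then have "(\<integral>\<^sup>+\<omega>. ennreal (1 / T) * ?J \<omega> \<partial>M) \<le> (\<integral>\<^sup>+\<omega>. ?U \<omega> \<partial>M)"
    by (intro nn_integral_mono)
  then have "ennreal (1 / T) * (\<integral>\<^sup>+\<omega>. ?J \<omega> \<partial>M) < \<infinity>"
    using S2 by (subst (asm) nn_integral_cmult) (auto simp: S2_process_def)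
  then have "(\<integral>\<^sup>+\<omega>. ?J \<omega> \<partial>M) < \<infinity>"
    using \<open>0 < T\<close> by (auto simp: ennreal_mult_less_top)
  then show ?thesis
    using S2 by (simp add: H2_process_def S2_process_def R)
qed

text \<open>Comparison with the zero arguments in (A1) bounds the integrand by \<open>norm (g
  \<omega> s 0 0) + C * (norm (Y s \<omega>) + norm (Z s \<omega>))\<close>, whose terms are
  integrable for almost every path. The result matters because the Bochner integral of a
  non-integrable function defaults to 0, which would spoil continuity in the lower limit.\<close>

lemma generator_along_processes_integrable:
  fixes g :: "'a \<Rightarrow> real \<Rightarrow> real \<Rightarrow> real^'d::finite \<Rightarrow> real"
  assumes sub: "\<And>t. subalgebra M (F t)" and "0 < T"
    and gen: "generator F T g" and A1: "cond_A1 M T g" and A2: "cond_A2 M F T g"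
    and Y: "H2_process M F T Y" and Z: "H2_process M F T Z"
  shows "AE \<omega> in M. set_integrable lborel {0..T} (\<lambda>s. g \<omega> s (Y s \<omega>) (Z s \<omega>))"
proof -
  let ?N = "restrict_space lborel {0..T}"
  have mY [measurable]: "(\<lambda>(t, \<omega>). Y t \<omega>) \<in> borel_measurable (?N \<Otimes>\<^sub>M M)"
    and mZ [measurable]: "(\<lambda>(t, \<omega>). Z t \<omega>) \<in> borel_measurable (?N \<Otimes>\<^sub>M M)"
    using predictable_measurable_product[OF sub] Y Z by (auto simp: H2_process_def)
  have mg: "(\<lambda>s. g \<omega> s y z) \<in> borel_measurable ?N" if "\<omega> \<in> space M" for \<omega> y z
  proof -
    \<comment> \<open>Progressive measurability at the terminal time covers all of
      \<open>{0..T}\<close>; fixing the path leaves measurability in time.\<close>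
    have "(\<lambda>(s, \<omega>). g \<omega> s y z) \<in> borel_measurable (restrict_space borel {0..T} \<Otimes>\<^sub>M F T)"
      using gen \<open>0 < T\<close> by (auto simp: generator_def progressively_measurable_def)
    moreover have "\<omega> \<in> space (F T)"
      using sub that by (simp add: subalgebra_def)
    ultimately have "(\<lambda>s. g \<omega> s y z) \<in> borel_measurable (restrict_space borel {0..T})"
      using measurable_Pair2'[of \<omega>] measurable_compose by force
    moreover have "sets ?N = sets (restrict_space borel {0..T})"
      by (rule sets_restrict_space_cong) simp
    ultimately show ?thesis
      using measurable_cong_sets by blast
  qed
  obtain C where "C > 0" and C: "AE \<omega> in M. \<forall>t\<in>{0..T}. \<forall>y1 y2 z1 z2.
     \<bar>g \<omega> t y1 z1 - g \<omega> t y2 z2\<bar> \<le> C * (\<bar>y1 - y2\<bar> + norm (z1 - z2))"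
    using A1 unfolding cond_A1_def by blast
  show ?thesis
    using C AE_space H2_process_AE_integrable[OF sub Y] H2_process_AE_integrable[OF sub Z]
      H2_process_AE_integrable[OF sub A2[unfolded cond_A2_def]]
  proof eventually_elim
    case (elim \<omega>)
    note lip = elim(1)[rule_format]
    let ?h = "\<lambda>s p. g \<omega> s (fst p) (snd p)"
    \<comment> \<open>The Lipschitz bound gives joint continuity in the pair \<open>(y, z)\<close>,
      the hypothesis of the composition lemma.\<close>
    have cont: "continuous_on UNIV (?h s)" if "s \<in> space ?N" for s
      unfolding continuous_on_def
    proof
      fix p :: "real \<times> (real^'d)"
      have "((\<lambda>q. C * (\<bar>fst q - fst p\<bar> + norm (snd q - snd p))) \<longlongrightarrow>
          C * (\<bar>fst p - fst p\<bar> + norm (snd p - snd p))) (at p)"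
        by (intro tendsto_intros)
      then have "((\<lambda>q. C * (\<bar>fst q - fst p\<bar> + norm (snd q - snd p))) \<longlongrightarrow> 0) (at p)"
        by simp
      then have "((\<lambda>q. ?h s q - ?h s p) \<longlongrightarrow> 0) (at p)"
        by (rule Lim_null_comparison[rotated])
          (use lip[of s] that in \<open>auto simp: space_restrict_space\<close>)
      then show "(?h s \<longlongrightarrow> ?h s p) (at p)"
        by (rule LIM_zero_cancel)
    qed
    have [measurable]: "(\<lambda>s. Y s \<omega>) \<in> borel_measurable ?N" "(\<lambda>s. Z s \<omega>) \<in> borel_measurable ?N"
      using elim(2) by measurable
    have "(\<lambda>s. ?h s (Y s \<omega>, Z s \<omega>)) \<in> borel_measurable ?N"
      by (rule borel_measurable_Caratheodory[OF _ cont]) (use mg elim(2) in auto)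
    then have m: "(\<lambda>s. g \<omega> s (Y s \<omega>) (Z s \<omega>)) \<in> borel_measurable ?N"
      by simp
    have "integrable ?N (\<lambda>s. norm (g \<omega> s 0 0) + C * (norm (Y s \<omega>) + norm (Z s \<omega>)))"
      using elim(3-5) by auto
    then have "integrable ?N (\<lambda>s. g \<omega> s (Y s \<omega>) (Z s \<omega>))"
    proof (rule Bochner_Integration.integrable_bound[OF _ m], intro AE_I2)
      fix s assume "s \<in> space ?N"
      then have "\<bar>g \<omega> s (Y s \<omega>) (Z s \<omega>) - g \<omega> s 0 0\<bar> \<le> C * (\<bar>Y s \<omega> - 0\<bar> + norm (Z s \<omega> - 0))"
        by (intro lip) (auto simp: space_restrict_space)
      then show "norm (g \<omega> s (Y s \<omega>) (Z s \<omega>))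
          \<le> norm (norm (g \<omega> s 0 0) + C * (norm (Y s \<omega>) + norm (Z s \<omega>)))"
        by simp
    qed
    then show ?case
      by (simp add: integrable_restrict_space set_integrable_def)
  qed
qed

section \<open>Path continuity and terminal value of a solution\<close>

text \<open>For an integrable function the Lebesgue integral coincides with the gauge integral,
  which is continuous in its lower limit.\<close>

lemma continuous_on_LINT_lower_limit:
  fixes f :: "real \<Rightarrow> real"
  assumes "set_integrable lborel {a..b} f"
  shows "continuous_on {a..b} (\<lambda>t. LINT s:{t..b}|lborel. f s)"
proof -
  have "(LINT s:{t..b}|lborel. f s) = integral {t..b} f" if "t \<in> {a..b}" for t
    by (rule set_borel_integral_eq_integral(2), rule set_integrable_subset[OF assms])
      (use that in auto)
  then show ?thesis
    using indefinite_integral_continuous_1'[OF set_borel_integral_eq_integral(1)[OF assms]]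
    by (subst continuous_on_cong[OF refl]) auto
qed

text \<open>Each term on the right of the equation is continuous in time: the drift by
  integrability, and \<open>K\<close> and \<open>I\<close> by assumption. These facts hold outside
  one null set, where the equation holds for all times at once.\<close>

lemma rbsde_solution_continuous:
  fixes M :: "'a measure" and B :: "real \<Rightarrow> 'a \<Rightarrow> real^'d::finite"
  defines "F \<equiv> brownian_filtration M B"
  assumes bm: "brownian_motion M B" and "0 < T"
    and gen: "generator F T g" and A1: "cond_A1 M T g" and A2: "cond_A2 M F T g"
    and sol: "rbsde_solution M B T \<xi> g S Y Z K"
  shows "AE \<omega> in M. continuous_on {0..T} (\<lambda>t. Y t \<omega>)" "AE \<omega> in M. Y T \<omega> = \<xi> \<omega>"
    "t \<in> {0..T} \<Longrightarrow> Y t \<in> borel_measurable M"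
proof -
  have sub: "subalgebra M (F t)" for t
    unfolding F_def by (rule subalgebra_brownian_filtration[OF bm])
  have Z: "H2_process M F T Z" and S2: "S2_process M F T Y"
    using sol by (auto simp: rbsde_solution_def Let_def F_def)
  have Y: "H2_process M F T Y"
    by (rule S2_process_imp_H2_process[OF sub S2 \<open>0 < T\<close>])
  obtain I where I: "AE \<omega> in M. continuous_on {0..T} (\<lambda>s. I s \<omega>)"
    and eq: "AE \<omega> in M. \<forall>t\<in>{0..T}. Y t \<omega> = \<xi> \<omega> + (LINT s:{t..T}|lborel. g \<omega> s (Y s \<omega>) (Z s \<omega>))
                    + K T \<omega> - K t \<omega> - (I T \<omega> - I t \<omega>)"
    using sol by (auto simp: rbsde_solution_def Let_def ito_integral_def)
  have K: "AE \<omega> in M. continuous_on {0..T} (\<lambda>t. K t \<omega>)"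
    using sol unfolding rbsde_solution_def Let_def by (elim conjE) (erule AE_mp, simp)
  note int = generator_along_processes_integrable[OF sub \<open>0 < T\<close> gen A1 A2 Y Z]
  show "AE \<omega> in M. continuous_on {0..T} (\<lambda>t. Y t \<omega>)"
    using I eq K int
  proof eventually_elim
    case (elim \<omega>)
    have "continuous_on {0..T} (\<lambda>t. \<xi> \<omega> + (LINT s:{t..T}|lborel. g \<omega> s (Y s \<omega>) (Z s \<omega>))
                    + K T \<omega> - K t \<omega> - (I T \<omega> - I t \<omega>))"
      by (intro continuous_intros continuous_on_LINT_lower_limit elim)
    then show ?case
      by (rule continuous_on_eq) (use elim(2) in auto)
  qed
  show "AE \<omega> in M. Y T \<omega> = \<xi> \<omega>"
    using eq int
  proof eventually_elim
    case (elim \<omega>)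
    \<comment> \<open>At \<open>t = T\<close> the increments of \<open>K\<close> and
      \<open>I\<close> cancel, and only a drift integral over a single point is left.\<close>
    have "set_integrable lborel {T..T} (\<lambda>s. g \<omega> s (Y s \<omega>) (Z s \<omega>))"
      by (rule set_integrable_subset[OF elim(2)]) (use \<open>0 < T\<close> in auto)
    from set_borel_integral_eq_integral(2)[OF this]
    have "(LINT s:{T..T}|lborel. g \<omega> s (Y s \<omega>) (Z s \<omega>)) = 0"
      by (metis cbox_interval integral_refl)
    then show ?case
      using elim(1) \<open>0 < T\<close> by force
  qed
  have "(\<lambda>(t, \<omega>). Y t \<omega>) \<in> borel_measurable (restrict_space lborel {0..T} \<Otimes>\<^sub>M M)"
    using predictable_measurable_product[OF sub] Y by (auto simp: H2_process_def)
  moreover assume "t \<in> {0..T}"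
  then have "t \<in> space (restrict_space lborel {0..T})"
    by (simp add: space_restrict_space)
  ultimately show "Y t \<in> borel_measurable M"
    using measurable_Pair1'[of t] measurable_compose by force
qed

section \<open>Strict comparison on a terminal interval\<close>

theorem theorem3p1:
  fixes M :: "'a measure"
    and B :: "real \<Rightarrow> 'a \<Rightarrow> real^'d::finite"
    and T :: real
    and g :: "'a \<Rightarrow> real \<Rightarrow> real \<Rightarrow> real^'d \<Rightarrow> real"
    and S Y1 Y2 K1 K2 :: "real \<Rightarrow> 'a \<Rightarrow> real"
    and Z1 Z2 :: "real \<Rightarrow> 'a \<Rightarrow> real^'d"
    and \<xi>1 \<xi>2 :: "'a \<Rightarrow> real"
  assumes "prob_space M"
    and "brownian_motion M B"
    and "T > 0"
    and "generator (brownian_filtration M B) T g"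
    and "cond_A1 M T g"
    and "cond_A2 M (brownian_filtration M B) T g"
    and "cond_A5 M (brownian_filtration M B) T S"
    and "L2_rv M (brownian_filtration M B T) \<xi>1"
    and "L2_rv M (brownian_filtration M B T) \<xi>2"
    and "AE \<omega> in M. S T \<omega> \<le> \<xi>1 \<omega>"
    and "AE \<omega> in M. S T \<omega> \<le> \<xi>2 \<omega>"
    and "AE \<omega> in M. \<xi>1 \<omega> \<le> \<xi>2 \<omega>"
    and "measure M {\<omega> \<in> space M. \<xi>1 \<omega> < \<xi>2 \<omega>} > 0"
    and "rbsde_solution M B T \<xi>1 g S Y1 Z1 K1"
    and "rbsde_solution M B T \<xi>2 g S Y2 Z2 K2"
  shows "\<exists>\<tau> :: 'a \<Rightarrow> real.
           stopping_time (brownian_filtration M B) \<tau> \<and>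
           (\<forall>\<omega>\<in>space M. 0 \<le> \<tau> \<omega>) \<and>
           (AE \<omega> in M. \<tau> \<omega> < T) \<and>
           measure (completion M) {\<omega> \<in> space M. \<forall>t\<in>{\<tau> \<omega>..T}. Y1 t \<omega> < Y2 t \<omega>} > 0"
proof -
  interpret prob_space M by fact
  note sol1 = rbsde_solution_continuous[OF assms(2-6) assms(14)]
  note sol2 = rbsde_solution_continuous[OF assms(2-6) assms(15)]
  define D where "D t \<omega> = Y2 t \<omega> - Y1 t \<omega>" for t \<omega>
  have D_meas: "D t \<in> borel_measurable M" if "t \<in> {0..T}" for t
    using sol1(3)[OF that] sol2(3)[OF that] unfolding D_def by measurable
  have D_cont: "AE \<omega> in M. continuous_on {0..T} (\<lambda>t. D t \<omega>)"
    using sol1(1) sol2(1) unfolding D_def by eventually_elim (intro continuous_intros)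
  have [measurable]: "\<xi>1 \<in> borel_measurable M" "\<xi>2 \<in> borel_measurable M"
    using assms(8,9) measurable_from_subalg[OF subalgebra_brownian_filtration[OF assms(2)]]
    by (auto simp: L2_rv_def)
  have [measurable]: "D T \<in> borel_measurable M"
    using D_meas \<open>T > 0\<close> by simp
  \<comment> \<open>Terminal values are attained only almost surely, so these two events agree up to
    a null set, which is enough to transfer the positive probability.\<close>
  have "AE \<omega> in M. \<omega> \<in> {\<omega> \<in> space M. 0 < D T \<omega>} \<longleftrightarrow> \<omega> \<in> {\<omega> \<in> space M. \<xi>1 \<omega> < \<xi>2 \<omega>}"
    using sol1(2) sol2(2) by eventually_elim (auto simp: D_def)
  then have "prob {\<omega> \<in> space M. 0 < D T \<omega>} = prob {\<omega> \<in> space M. \<xi>1 \<omega> < \<xi>2 \<omega>}"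
    by (rule measure_eq_AE) measurable
  then obtain a where "a \<in> {0..<T}"
    and "measure (completion M) {\<omega> \<in> space M. \<forall>t\<in>{a..T}. 0 < D t \<omega>} > 0"
    using positive_on_terminal_interval[OF D_meas D_cont \<open>T > 0\<close>] assms(13) by auto
  then show ?thesis
    by (intro exI[of _ "\<lambda>_. a"]) (auto simp: stopping_time_const D_def)
qed

end
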